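(* Let $g\geq1$ be an integer. Then there exists a family of polynomial functions $P_{g,m}:[0,1]\to\mathbb R$, $m=0,1,\dots,g-1$, such that for any integer $k\geq1$ and any odd integer $\ell$ satisfying $1\leq\ell\leq k-1$, $$N^{g,k}_\ell=\Bigl(\frac{k}{2\pi}\Bigr)^{3g-2}\sum_{m=0}^{g-1}k^{-2m}P_{g,m}\Bigl(\frac{\ell}{k}\Bigr).$$ Furthermore $P_{g,m}$ has degree $2(g-m)-1$, and the even part of $P_{g,m}$ is of the form $\lambda_{g,m}x^{2(g-m-1)}$ for some constant $\lambda_{g,m}$. For $m=0$, $$\lambda_{g,0}=\frac{2C_g(2\pi)^{3g-2}}{(2(g-1))!},\qquad C_g=(-1)^{g-1}2^{-g}.$$
   Context: For integers $g\ge1$, $k\geq1$ and $1\leq\ell\leq k-1$, $N_\ell^{g,k}$ is the dimension of the vector space associated by the $\mathrm{SU}(2)$ Chern–Simons topological quantum field theory at level $k-2$ to a genus $g$ surface with one marked point colored by $\ell$ (colors are $1,\dots,k-1$, $\ell$ corresponding to the $\ell$-dimensional irreducible representation). By the Verlinde formula, $N_\ell^{g,k}=\sum_{m=1}^{k-1}S_{m,1}^{1-2g}S_{m,\ell}$ with $S_{m,p}=(2/k)^{1/2}\sin(\pi mp/k)$, which may be taken as the definition. The even part of a polynomial is the sum of its monomials of even degree. *)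

theory Defs
  imports Complex_Main "HOL-Computational_Algebra.Polynomial"
begin

definition S_matrix :: "nat \<Rightarrow> nat \<Rightarrow> nat \<Rightarrow> real" where
  "S_matrix k m p = sqrt (2 / real k) * sin (pi * real m * real p / real k)"

text \<open>The TQFT dimension of a genus \<open>g\<close> surface with one marked point coloured by \<open>l\<close>,
  at level \<open>k - 2\<close>, defined by the Verlinde formula.\<close>

definition verlinde_dim :: "nat \<Rightarrow> nat \<Rightarrow> nat \<Rightarrow> real" where
  "verlinde_dim g k l = (\<Sum>m = 1..k - 1. S_matrix k m 1 powi (1 - 2 * int g) * S_matrix k m l)"

definition even_part :: "'a::comm_monoid_add poly \<Rightarrow> 'a poly" where
  "even_part p = (\<Sum>i | i \<le> degree p \<and> even i. monom (coeff p i) i)"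

definition C_const :: "nat \<Rightarrow> real" where
  "C_const g = (-1) ^ (g - 1) * 2 powi (- int g)"

end

theory Submission
  imports Defs
begin

text \<open>Put \<open>n = g - 1\<close>. As a function of odd \<open>l\<close>, the sum over \<open>m\<close> of
  \<open>sin (\<pi> m l / k) / sin (\<pi> m / k) ^ (2 n + 1)\<close> is odd about \<open>0\<close> and about \<open>k\<close>, and its second
  difference with step \<open>2\<close> is \<open>- 4\<close> times the same sum for \<open>n - 1\<close>; for \<open>n = 0\<close> it equals \<open>k - l\<close>
  on \<open>[1, 2 k - 1]\<close>. A polynomial that is odd about \<open>k\<close> is determined by its even part. So the
  polynomials odd about \<open>k\<close> with even part \<open>k (- 1) ^ n / (2 n)!\<close> times the product of
  \<open>l\<^sup>2 - (2 j + 1)\<^sup>2\<close> over \<open>j < n\<close> satisfy the same recursion, and since this even part vanishes at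
  \<open>l = 1\<close> for \<open>n > 0\<close>, they also satisfy the same boundary conditions and agree with the sums.\<close>

section \<open>Even parts and reflection symmetries of polynomials\<close>

lemma poly_even_part: "2 * poly (even_part p) x = poly p x + poly p (- x)"
  for p :: "real poly"
proof -
  have "poly p x + poly p (- x) = (\<Sum>i\<le>degree p. coeff p i * x ^ i + coeff p i * (- x) ^ i)"
    by (simp add: poly_altdef sum.distrib)
  also have "\<dots> = (\<Sum>i\<le>degree p. if even i then 2 * (coeff p i * x ^ i) else 0)"
    by (rule sum.cong) auto
  also have "\<dots> = (\<Sum>i | i \<in> {..degree p} \<and> even i. 2 * (coeff p i * x ^ i))"
    by (rule sum.inter_filter[symmetric]) simp
  also have "\<dots> = 2 * poly (even_part p) x"
    by (simp add: even_part_def poly_sum poly_monom sum_distrib_left)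
  finally show ?thesis by simp
qed

lemma coeff_even_part: "coeff (even_part p) i = (if even i then coeff p i else 0)"
proof -
  have "coeff (even_part p) i
      = (\<Sum>j | j \<le> degree p \<and> even j. if j = i then coeff p j else 0)"
    by (simp add: even_part_def coeff_sum)
  also have "\<dots> = (if i \<le> degree p \<and> even i then coeff p i else 0)"
    by (subst sum.delta) auto
  finally show ?thesis by (auto simp: coeff_eq_0 not_le)
qed

lemma even_part_smult: "even_part (smult c p) = smult c (even_part p)"
  for p :: "'a::comm_semiring_0 poly"
  by (rule poly_eqI) (simp add: coeff_even_part)

text \<open>The two reflections compose to the translation by \<open>2 * c\<close>, so the zero of
  \<open>q\<close> at 0 recurs infinitely often. Hence an identity between polynomials odd about
  \<open>c\<close> need only be checked on even parts.\<close>

lemma poly_eq_0_if_odd_about_two_points: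
  fixes q :: "real poly"
  assumes "c > 0" and odd: "\<And>x. poly q (- x) = - poly q x"
    and refl: "\<And>x. poly q (2 * c - x) = - poly q x"
  shows "q = 0"
proof (rule ccontr)
  assume "q \<noteq> 0"
  have per: "poly q (x + 2 * c) = poly q x" for x
    using refl[of "- x"] odd[of x] by (simp add: add.commute)
  have zero: "poly q (2 * c * real n) = 0" for n
  proof (induction n)
    case 0
    show ?case using odd[of 0] by simp
  next
    case (Suc n)
    then show ?case using per[of "2 * c * real n"] by (simp add: algebra_simps)
  qed
  have "inj (\<lambda>n. 2 * c * real n)" using \<open>c > 0\<close> by (auto simp: inj_def)
  then have "infinite (range (\<lambda>n. 2 * c * real n))" by (rule range_inj_infinite)
  moreover have "range (\<lambda>n. 2 * c * real n) \<subseteq> {x. poly q x = 0}" using zero by auto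
  ultimately show False using poly_roots_finite[OF \<open>q \<noteq> 0\<close>] finite_subset by blast
qed

section \<open>Bernoulli-type polynomials with a single even monomial\<close>

text \<open>Up to normalisation, \<open>bern n\<close> is the Bernoulli polynomial \<open>B\<close> of index \<open>2 n + 1\<close> at \<open>x / 2\<close>.
  The recursion inverts the triangular system giving the even parts of the powers
  \<open>(x - 1) ^ (2 n + 1)\<close>.\<close>

function bern :: "nat \<Rightarrow> real poly" where
  "bern n = smult (- 1 / real (2 * n + 1))
     ([:- 1, 1:] ^ (2 * n + 1) + (\<Sum>j\<in>{..<n}. smult (real ((2 * n + 1) choose (2 * j))) (bern j)))"
  by auto
termination by (relation "measure id") auto

declare bern.simps [simp del]

text \<open>Oddness about 1 passes from \<open>(x - 1) ^ (2 * n + 1)\<close> through the linear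
  recursion.\<close>

lemma poly_bern_reflect: "poly (bern n) (2 - x) = - poly (bern n) x"
proof (induction n rule: less_induct)
  case (less n)
  have "(1 - x) ^ (2 * n + 1) = - ((x - 1) ^ (2 * n + 1))"
    using power_minus_odd[of "2 * n + 1" "x - 1"] by simp
  then have pow: "poly ([:- 1, 1:] ^ (2 * n + 1)) (2 - x) = - poly ([:- 1, 1:] ^ (2 * n + 1)) x"
    by (simp only: poly_power) simp
  have "(\<Sum>j<n. real ((2 * n + 1) choose (2 * j)) * poly (bern j) (2 - x))
      = - (\<Sum>j<n. real ((2 * n + 1) choose (2 * j)) * poly (bern j) x)"
    using less by (simp add: sum_negf)
  then show ?case
    unfolding bern.simps[of n] poly_smult poly_add poly_sum pow
    by (simp only: mult_minus_right minus_add_distrib distrib_left)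
qed

text \<open>The even coefficients of \<open>(x - 1) ^ (2 * n + 1)\<close> are negated binomials. The
  sum over \<open>j < n\<close> cancels those below degree \<open>2 * n\<close>, and the prefactor
  normalises the remaining one, \<open>- (2 * n + 1)\<close>.\<close>

lemma coeff_bern_even: "coeff (bern n) (2 * i) = (if i = n then 1 else 0)"
proof (induction n rule: less_induct)
  case (less n)
  have "(\<Sum>j<n. real ((2 * n + 1) choose (2 * j)) * coeff (bern j) (2 * i))
      = (\<Sum>j<n. if j = i then real ((2 * n + 1) choose (2 * i)) else 0)"
    using less by (intro sum.cong) auto
  also have "\<dots> = (if i < n then real ((2 * n + 1) choose (2 * i)) else 0)" by simp
  finally have sum: "(\<Sum>j<n. real ((2 * n + 1) choose (2 * j)) * coeff (bern j) (2 * i))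
      = (if i < n then real ((2 * n + 1) choose (2 * i)) else 0)" .
  have pow: "coeff ([:- 1, 1:] ^ (2 * n + 1)) (2 * i) = - real ((2 * n + 1) choose (2 * i))"
  proof (cases "i \<le> n")
    case True
    then have "odd (2 * n + 1 - 2 * i)" by simp
    moreover have "2 * i \<le> 2 * n + 1" using True by simp
    ultimately show ?thesis by (subst coeff_linear_poly_power) auto
  next
    case False
    then have "2 * n + 1 < 2 * i" by simp
    then show ?thesis
      by (simp only: coeff_eq_0 degree_linear_power binomial_eq_0)
  qed
  have "(2 * n + 1) choose (2 * n) = 2 * n + 1"
    using binomial_symmetric[of "2 * n" "2 * n + 1"] by simp
  then show ?case
    by (subst bern.simps)
      (simp only: coeff_smult coeff_add coeff_sum pow sum, auto simp: field_simps)
qed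

lemma even_part_bern: "even_part (bern n) = monom 1 (2 * n)"
  by (rule poly_eqI) (auto simp: coeff_even_part coeff_bern_even elim!: evenE)

lemma poly_bern_even: "poly (bern n) x + poly (bern n) (- x) = 2 * x ^ (2 * n)"
  using poly_even_part[of "bern n" x] by (simp add: even_part_bern poly_monom)

lemma degree_bern: "degree (bern n) = 2 * n + 1"
proof (induction n rule: less_induct)
  case (less n)
  have "degree (\<Sum>j\<in>{..<n}. smult (real ((2 * n + 1) choose (2 * j))) (bern j)) < 2 * n + 1"
    using less by (intro degree_sum_less) (auto intro: le_less_trans[OF degree_smult_le])
  moreover have "degree ([:- 1, 1:] ^ (2 * n + 1) :: real poly) = 2 * n + 1"
    by (rule degree_linear_power)
  ultimately show ?case by (subst bern.simps) (simp add: degree_add_eq_left)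
qed

section \<open>Products over odd squares and their second differences\<close>

text \<open>The variable stands for a square: evaluation at \<open>x\<^sup>2\<close> gives an even
  function of \<open>x\<close>.\<close>

definition odd_squares_poly :: "nat \<Rightarrow> real poly" where
  "odd_squares_poly n = (\<Prod>j<n. [:- (real (2 * j + 1))\<^sup>2, 1:])"

lemma odd_squares_poly_Suc:
  "odd_squares_poly (Suc n) = odd_squares_poly n * [:- (real (2 * n + 1))\<^sup>2, 1:]"
  by (simp add: odd_squares_poly_def)

lemma degree_odd_squares_poly: "degree (odd_squares_poly n) = n"
  by (simp add: odd_squares_poly_def degree_prod_sum_eq)

lemma lead_coeff_odd_squares_poly: "coeff (odd_squares_poly n) n = 1"
proof -
  have "lead_coeff (odd_squares_poly n) = 1"
    by (simp add: odd_squares_poly_def lead_coeff_prod)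
  then show ?thesis by (simp add: degree_odd_squares_poly)
qed

text \<open>All roots are positive, so the coefficients alternate strictly in sign. Their
  nonvanishing later yields the exact degree of every \<open>P m\<close>.\<close>

lemma coeff_odd_squares_poly_alternate:
  "i \<le> n \<Longrightarrow> (- 1) ^ (n - i) * coeff (odd_squares_poly n) i > 0"
proof (induction n arbitrary: i)
  case 0
  then show ?case by (simp add: odd_squares_poly_def)
next
  case (Suc n)
  define a where "a = (real (2 * n + 1))\<^sup>2"
  have a: "a > 0" by (simp add: a_def)
  have eq: "odd_squares_poly (Suc n) = pCons 0 (odd_squares_poly n) - smult a (odd_squares_poly n)"
    by (simp add: odd_squares_poly_Suc a_def)
  show ?case
  proof (cases "i = Suc n")
    case True
    then show ?thesis by (simp add: lead_coeff_odd_squares_poly)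
  next
    case False
    with Suc.prems have "i \<le> n" by simp
    \<comment> \<open>This term vanishes at \<open>i = 0\<close>; strict positivity comes from the
      other one.\<close>
    have "(- 1) ^ (Suc n - i) * coeff (pCons 0 (odd_squares_poly n)) i \<ge> 0"
      using Suc.IH[of "i - 1"] \<open>i \<le> n\<close> by (cases i) (auto simp: Suc_diff_le less_imp_le)
    moreover have "a * ((- 1) ^ (n - i) * coeff (odd_squares_poly n) i) > 0"
      using Suc.IH[OF \<open>i \<le> n\<close>] a by simp
    ultimately show ?thesis
      using \<open>i \<le> n\<close> by (simp add: eq Suc_diff_le algebra_simps)
  qed
qed

lemma coeff_odd_squares_poly_nonzero: "i \<le> n \<Longrightarrow> coeff (odd_squares_poly n) i \<noteq> 0"
  using coeff_odd_squares_poly_alternate[of i n] by auto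

text \<open>At \<open>x\<^sup>2\<close> the product of index \<open>n\<close> has the factors
  \<open>x + c\<close> with \<open>c\<close> odd, from \<open>- (2 * n - 1)\<close> to
  \<open>2 * n - 1\<close>. The shift slides the longer window \<open>- (2 * n + 1)\<close> to
  \<open>2 * n + 1\<close> so that it overhangs this one by two factors on the right.\<close>

lemma poly_odd_squares_shift:
  "poly (odd_squares_poly (Suc n)) ((x + 2)\<^sup>2)
     = poly (odd_squares_poly n) (x\<^sup>2) * ((x + real (2 * n + 1)) * (x + real (2 * n + 3)))"
proof (induction n)
  case 0
  show ?case by (simp add: odd_squares_poly_def power2_eq_square algebra_simps)
next
  case (Suc n)
  have "poly (odd_squares_poly (Suc (Suc n))) ((x + 2)\<^sup>2)
      = poly (odd_squares_poly n) (x\<^sup>2) * ((x + real (2 * n + 1)) * (x + real (2 * n + 3)))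
        * ((x + 2)\<^sup>2 - (real (2 * Suc n + 1))\<^sup>2)"
    by (subst odd_squares_poly_Suc) (simp add: Suc.IH algebra_simps)
  also have "\<dots> = poly (odd_squares_poly (Suc n)) (x\<^sup>2)
        * ((x + real (2 * Suc n + 1)) * (x + real (2 * Suc n + 3)))"
    by (simp add: odd_squares_poly_Suc[of n]) (simp add: power2_eq_square algebra_simps)
  finally show ?case .
qed

text \<open>With \<open>a = 2 * n + 1\<close>, removing the common factor leaves \<open>(x + a) * (x
  + a + 2) - 2 * (x\<^sup>2 - a\<^sup>2) + (x - a) * (x - a - 2)\<close>, which is
  \<open>4 * a * (a + 1)\<close>.\<close>

lemma poly_odd_squares_second_difference:
  "poly (odd_squares_poly (Suc n)) ((x + 2)\<^sup>2) - 2 * poly (odd_squares_poly (Suc n)) (x\<^sup>2)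
     + poly (odd_squares_poly (Suc n)) ((x - 2)\<^sup>2)
   = 4 * real (2 * n + 1) * real (2 * n + 2) * poly (odd_squares_poly n) (x\<^sup>2)"
proof -
  \<comment> \<open>The backward shift is the forward shift at \<open>- x\<close>.\<close>
  have "(x - 2)\<^sup>2 = (- x + 2)\<^sup>2" by (simp add: power2_eq_square algebra_simps)
  then show ?thesis
    using poly_odd_squares_shift[of n x] poly_odd_squares_shift[of n "- x"]
    by (simp add: odd_squares_poly_Suc power2_eq_square algebra_simps)
qed

lemma poly_odd_squares_1: "poly (odd_squares_poly (Suc n)) 1 = 0"
proof -
  have "poly [:- (real (2 * 0 + 1))\<^sup>2, 1:] 1 = 0" by simp
  then show ?thesis unfolding odd_squares_poly_def poly_prod by (intro prod_zero) blast+
qed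

text \<open>The prefactor turns the \<open>4 * (2 * n + 1) * (2 * n + 2)\<close> of the second
  difference into \<open>- 4\<close>, the constant in the recursion of the sine sums.\<close>

definition even_coeff :: "nat \<Rightarrow> nat \<Rightarrow> real" where
  "even_coeff n j = (- 1) ^ n / fact (2 * n) * coeff (odd_squares_poly n) j"

definition even_fun :: "nat \<Rightarrow> real \<Rightarrow> real" where
  "even_fun n x = (- 1) ^ n / fact (2 * n) * poly (odd_squares_poly n) (x\<^sup>2)"

lemma even_fun_altdef: "even_fun n x = (\<Sum>j\<le>n. even_coeff n j * x ^ (2 * j))"
  by (simp add: even_fun_def even_coeff_def poly_altdef degree_odd_squares_poly
      sum_distrib_left power_mult mult.assoc)

lemma even_fun_second_difference:
  "even_fun (Suc n) (x + 2) - 2 * even_fun (Suc n) x + even_fun (Suc n) (x - 2)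
     = - 4 * even_fun n x"
proof -
  define c where "c = (- 1) ^ Suc n / (fact (2 * Suc n) :: real)"
  define a b where "a = real (2 * n + 1)" and "b = real (2 * n + 2)"
  have "c = - ((- 1) ^ n / fact (2 * n)) / (a * b)"
    by (simp add: c_def a_def b_def mult_ac)
  moreover have "a \<noteq> 0" "b \<noteq> 0" by (simp_all add: a_def b_def)
  ultimately have c: "c * (4 * a * b) = - 4 * ((- 1) ^ n / fact (2 * n))"
    by simp
  have "even_fun (Suc n) (x + 2) - 2 * even_fun (Suc n) x + even_fun (Suc n) (x - 2)
    = c * (4 * a * b * poly (odd_squares_poly n) (x\<^sup>2))"
    unfolding a_def b_def poly_odd_squares_second_difference[symmetric]
    unfolding even_fun_def c_def[symmetric] by (simp add: algebra_simps)
  also have "\<dots> = - 4 * even_fun n x"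
    using arg_cong[OF c, of "\<lambda>t. t * poly (odd_squares_poly n) (x\<^sup>2)"]
    by (simp add: even_fun_def mult_ac)
  finally show ?thesis .
qed

lemma even_fun_1: "even_fun (Suc n) 1 = 0"
  by (simp add: even_fun_def poly_odd_squares_1)

section \<open>The polynomials odd about \<open>k\<close> with prescribed even part\<close>

text \<open>Rescaling moves the centre of \<open>bern j\<close> from 1 to \<open>k\<close>; the
  factor \<open>k ^ (2 * j + 1)\<close> makes the even part \<open>k * even_fun n\<close>.\<close>

definition verlinde_poly :: "real \<Rightarrow> nat \<Rightarrow> real poly" where
  "verlinde_poly k n
     = (\<Sum>j\<le>n. smult (even_coeff n j * k ^ (2 * j + 1)) (bern j \<circ>\<^sub>p [:0, 1 / k:]))"

lemma poly_verlinde_poly: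
  "poly (verlinde_poly k n) x
     = (\<Sum>j\<le>n. even_coeff n j * k ^ (2 * j + 1) * poly (bern j) (x / k))"
  by (simp add: verlinde_poly_def poly_sum poly_pcompose)

lemma verlinde_poly_reflect:
  assumes "k \<noteq> 0"
  shows "poly (verlinde_poly k n) (2 * k - x) = - poly (verlinde_poly k n) x"
proof -
  have "(2 * k - x) / k = 2 - x / k" using assms by (simp add: field_simps)
  then show ?thesis by (simp add: poly_verlinde_poly poly_bern_reflect sum_negf)
qed

lemma verlinde_poly_even:
  assumes "k \<noteq> 0"
  shows "poly (verlinde_poly k n) x + poly (verlinde_poly k n) (- x) = 2 * k * even_fun n x"
proof -
  have "poly (verlinde_poly k n) x + poly (verlinde_poly k n) (- x)
    = (\<Sum>j\<le>n. even_coeff n j * k ^ (2 * j + 1)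
         * (poly (bern j) (x / k) + poly (bern j) (- (x / k))))"
    by (simp add: poly_verlinde_poly distrib_left sum.distrib)
  also have "\<dots> = (\<Sum>j\<le>n. 2 * k * (even_coeff n j * x ^ (2 * j)))"
    unfolding poly_bern_even using assms
    by (intro sum.cong) (auto simp: power_divide)
  finally show ?thesis by (simp add: even_fun_altdef sum_distrib_left)
qed

text \<open>The defect \<open>q\<close> of the recursion is odd about \<open>k\<close>, and odd
  about 0 because the even parts satisfy the recursion; so it is zero.\<close>

lemma verlinde_poly_second_difference:
  assumes "k > 0"
  shows "poly (verlinde_poly k (Suc n)) (x + 2) - 2 * poly (verlinde_poly k (Suc n)) x
     + poly (verlinde_poly k (Suc n)) (x - 2) = - 4 * poly (verlinde_poly k n) x"
proof -
  let ?R = "verlinde_poly k (Suc n)"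
  define q where "q = ?R \<circ>\<^sub>p [:2, 1:] - smult 2 ?R + ?R \<circ>\<^sub>p [:- 2, 1:] + smult 4 (verlinde_poly k n)"
  have q: "poly q y = poly ?R (y + 2) - 2 * poly ?R y + poly ?R (y - 2)
      + 4 * poly (verlinde_poly k n) y" for y
    by (simp add: q_def poly_pcompose add.commute)
  have "k \<noteq> 0" using assms by simp
  note refl = verlinde_poly_reflect[OF this] and even = verlinde_poly_even[OF this]
  have "poly q (2 * k - y) = - poly q y" for y
    using refl[of "Suc n" y] refl[of n y] refl[of "Suc n" "y - 2"] refl[of "Suc n" "y + 2"]
    by (simp add: q algebra_simps)
  moreover have "poly q (- y) = - poly q y" for y
  proof -
    have "- (y + 2) = - y - 2" "- (y - 2) = - y + 2" by simp_all
    then have "poly q y + poly q (- y)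
      = 2 * k * (even_fun (Suc n) (y + 2) - 2 * even_fun (Suc n) y + even_fun (Suc n) (y - 2)
          + 4 * even_fun n y)"
      using even[of "Suc n" y] even[of n y] even[of "Suc n" "y - 2"] even[of "Suc n" "y + 2"]
      unfolding q by (simp add: algebra_simps)
    then show ?thesis by (simp add: even_fun_second_difference)
  qed
  ultimately have "q = 0" using poly_eq_0_if_odd_about_two_points[OF assms] by blast
  then show ?thesis using q[of x] by simp
qed

section \<open>Trigonometric sums\<close>

text \<open>An integer argument makes the reflections and the boundary point \<open>l = - 1\<close>
  available.\<close>

definition sine_sum :: "nat \<Rightarrow> nat \<Rightarrow> int \<Rightarrow> real" where
  "sine_sum k n l
     = (\<Sum>m = 1..k - 1. sin (pi * real m * l / real k) / sin (pi * real m / real k) ^ (2 * n + 1))"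

lemma sin_pi_frac_pos: "m \<in> {1..k - 1} \<Longrightarrow> sin (pi * real m / real k) > 0"
  by (rule sin_gt_zero) (auto simp: field_simps)

lemma sine_sum_odd: "sine_sum k n (- l) = - sine_sum k n l"
  by (simp add: sine_sum_def sum_negf)

lemma sine_sum_reflect: "sine_sum k n (2 * int k - l) = - sine_sum k n l"
proof -
  have "sin (pi * real m * (2 * real k - l) / real k) = - sin (pi * real m * l / real k)"
    if "k > 0" for m
  proof -
    have "pi * real m * (2 * real k - l) / real k = 2 * real m * pi - pi * real m * l / real k"
      using that by (simp add: field_simps)
    then show ?thesis by (simp add: sin_diff)
  qed
  \<comment> \<open>For \<open>k = 0\<close> truncated subtraction makes the sum empty.\<close>
  then show ?thesis by (cases "k = 0") (simp_all add: sine_sum_def sum_negf)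
qed

text \<open>The second difference multiplies each summand by \<open>- 4 * (sin t)\<^sup>2\<close>,
  where \<open>t = pi * m / k\<close>, which lowers the exponent of the denominator by 2.\<close>

lemma sine_sum_second_difference:
  "sine_sum k (Suc n) (l + 2) - 2 * sine_sum k (Suc n) l + sine_sum k (Suc n) (l - 2)
     = - 4 * sine_sum k n l"
proof -
  have "sin (pi * real m * of_int (l + 2) / real k) / sin (pi * real m / real k) ^ (2 * Suc n + 1)
      - 2 * (sin (pi * real m * l / real k) / sin (pi * real m / real k) ^ (2 * Suc n + 1))
      + sin (pi * real m * of_int (l - 2) / real k) / sin (pi * real m / real k) ^ (2 * Suc n + 1)
    = - 4 * (sin (pi * real m * l / real k) / sin (pi * real m / real k) ^ (2 * n + 1))"
    if "m \<in> {1..k - 1}" for m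
  proof -
    define t u where "t = pi * real m / real k" and "u = pi * real m * l / real k"
    have t: "sin t \<noteq> 0" using sin_pi_frac_pos[OF that] by (simp add: t_def)
    have "pi * real m * of_int (l + 2) / real k = u + 2 * t"
         "pi * real m * of_int (l - 2) / real k = u - 2 * t"
      using that by (auto simp: t_def u_def field_simps)
    moreover have "sin (u + 2 * t) - 2 * sin u + sin (u - 2 * t) = - 4 * (sin t)\<^sup>2 * sin u"
      unfolding sin_add sin_diff cos_double_sin by (simp add: algebra_simps)
    moreover have "- 4 * (sin t)\<^sup>2 * sin u / sin t ^ (2 * Suc n + 1) = - 4 * (sin u / sin t ^ (2 * n + 1))"
      using t by (simp add: field_simps power2_eq_square)
    ultimately show ?thesis
      unfolding t_def[symmetric] u_def[symmetric]
      by (metis (no_types, lifting) add_divide_distrib diff_divide_distrib times_divide_eq_right)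
  qed
  then show ?thesis
    unfolding sine_sum_def sum_distrib_left sum_subtractf[symmetric] sum.distrib[symmetric]
    by (rule sum.cong[OF refl])
qed

text \<open>Multiplied by \<open>2 * sin t\<close>, the sum telescopes between two values of sine
  whose arguments differ by a multiple of \<open>2 * pi\<close>.\<close>

lemma sum_cos_roots_of_unity:
  assumes "0 < j" "j < k"
  shows "(\<Sum>m<k. cos (2 * pi * real m * real j / real k)) = 0"
proof -
  define t where "t = pi * real j / real k"
  have t: "sin t > 0" using sin_pi_frac_pos[of j k] assms by (simp add: t_def)
  define h where "h m = sin ((2 * real m - 1) * t)" for m
  have "2 * sin t * cos (2 * pi * real m * real j / real k) = h (Suc m) - h m" for m
  proof -
    have *: "(2 * real (Suc m) - 1) * t = 2 * real m * t + t"
            "(2 * real m - 1) * t = 2 * real m * t - t"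
      by (simp_all add: algebra_simps)
    have "2 * pi * real m * real j / real k = 2 * real m * t" by (simp add: t_def)
    then show ?thesis unfolding h_def * by (simp add: sin_add sin_diff)
  qed
  then have sum: "2 * sin t * (\<Sum>m<k. cos (2 * pi * real m * real j / real k)) = h k - h 0"
    by (simp add: sum_distrib_left sum_lessThan_telescope)
  have "(2 * real k - 1) * t = 2 * real j * pi - t"
    using assms by (simp add: t_def field_simps)
  then have "h k = h 0"
    by (simp only: h_def sin_diff sin_2npi cos_2npi) simp
  then show ?thesis using sum t by simp
qed

text \<open>At \<open>i = 1\<close> all \<open>k - 1\<close> summands are 1. Each further step adds
  twice a sum of cosines that lacks only the term \<open>m = 0\<close> of a vanishing sum, hence
  \<open>- 2\<close>.\<close>

lemma sine_sum_0:
  assumes "1 \<le> i" "i \<le> k"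
  shows "sine_sum k 0 (2 * int i - 1) = real k - (2 * real i - 1)"
  using assms
proof (induction i rule: dec_induct)
  case base
  have "sine_sum k 0 1 = (\<Sum>m = 1..k - 1. 1)"
    unfolding sine_sum_def using sin_pi_frac_pos by (intro sum.cong) (auto simp: less_le)
  then show ?case using \<open>1 \<le> k\<close> by simp
next
  case (step i)
  have "sine_sum k 0 (2 * int (Suc i) - 1) - sine_sum k 0 (2 * int i - 1)
    = (\<Sum>m = 1..k - 1. 2 * cos (2 * pi * real m * real i / real k))"
    unfolding sine_sum_def sum_subtractf[symmetric]
  proof (rule sum.cong[OF refl])
    fix m assume m: "m \<in> {1..k - 1}"
    define t u where "t = pi * real m / real k" and "u = 2 * pi * real m * real i / real k"
    have "pi * real m * of_int (2 * int (Suc i) - 1) / real k = u + t"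
         "pi * real m * of_int (2 * int i - 1) / real k = u - t"
      by (simp_all add: t_def u_def algebra_simps add_divide_distrib diff_divide_distrib)
    moreover have "sin t > 0" using sin_pi_frac_pos[OF m] by (simp add: t_def)
    ultimately show "sin (pi * real m * of_int (2 * int (Suc i) - 1) / real k)
        / sin (pi * real m / real k) ^ (2 * 0 + 1)
      - sin (pi * real m * of_int (2 * int i - 1) / real k) / sin (pi * real m / real k) ^ (2 * 0 + 1)
      = 2 * cos (2 * pi * real m * real i / real k)"
      unfolding t_def[symmetric] u_def[symmetric]
      by (simp only: sin_add sin_diff) (simp add: field_simps)
  qed
  also have "\<dots> = 2 * (\<Sum>m = 1..k - 1. cos (2 * pi * real m * real i / real k))"
    by (simp add: sum_distrib_left)
  also have "(\<Sum>m = 1..k - 1. cos (2 * pi * real m * real i / real k)) = - 1"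
  proof -
    have "{..<k} = insert 0 {1..k - 1}" using step.prems by auto
    then show ?thesis using sum_cos_roots_of_unity[of i k] step by simp
  qed
  finally show ?case using step by simp
qed

section \<open>Comparison of the sums with the polynomials\<close>

text \<open>The discrete analogue of a linear function that is odd about both \<open>1/2\<close> and \<open>(k + 1)/2\<close>.\<close>

lemma zero_if_second_difference_zero:
  fixes d :: "nat \<Rightarrow> real"
  assumes lin: "\<And>i. i < k \<Longrightarrow> d (i + 2) - 2 * d (i + 1) + d i = 0"
    and "d 0 = - d 1" "d k = - d 1" "k > 0" "i \<le> k + 1"
  shows "d i = 0"
proof -
  have *: "d i = (2 * real i - 1) * d 1" if "i \<le> k + 1" for i
    using that
  proof (induction i rule: less_induct)
    case (less i)
    consider "i = 0" | "i = 1" | j where "i = j + 2"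
      by (metis One_nat_def add_2_eq_Suc' old.nat.exhaust)
    then show ?case
    proof cases
      case 3
      then show ?thesis
        using lin[of j] less.IH[of j] less.IH[of "j + 1"] less.prems by (simp add: algebra_simps)
    qed (use assms in simp_all)
  qed
  \<comment> \<open>At \<open>k\<close> the formula gives \<open>(2 * k - 1) * d 1\<close>, which
    must equal \<open>- d 1\<close>.\<close>
  have "2 * real k * d 1 = 0"
    using *[of k] assms(3) by (simp add: algebra_simps)
  then have "d 1 = 0" using \<open>k > 0\<close> by simp
  then show ?thesis using *[OF \<open>i \<le> k + 1\<close>] by simp
qed

text \<open>The range covers the odd arguments from 1 to \<open>2 * k - 1\<close>, on both sides of
  the centre \<open>k\<close>, so that the reflection about \<open>k\<close> supplies the second
  boundary condition.\<close>

lemma sine_sum_eq_verlinde_poly: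
  assumes "1 \<le> i" "i \<le> k"
  shows "sine_sum k n (2 * int i - 1) = poly (verlinde_poly (real k) n) (2 * real i - 1)"
  using assms
proof (induction n arbitrary: i)
  case 0
  \<comment> \<open>Hence the polynomial for \<open>n = 0\<close> is
    \<open>k * (1 - x / k) = k - x\<close>.\<close>
  have "bern 0 = [:1, - 1:]" by (subst bern.simps) simp
  then show ?case
    unfolding sine_sum_0[OF 0] using 0
    by (simp add: poly_verlinde_poly even_coeff_def odd_squares_poly_def field_simps)
next
  case (Suc n)
  have k: "real k > 0" "real k \<noteq> 0" "k > 0" using Suc.prems by simp_all
  let ?R = "verlinde_poly (real k)"
  define d where "d i = sine_sum k (Suc n) (2 * int i - 1) - poly (?R (Suc n)) (2 * real i - 1)" for i
  have "d i = 0"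
  proof (rule zero_if_second_difference_zero)
    fix i assume "i < k"
    then show "d (i + 2) - 2 * d (i + 1) + d i = 0"
      using Suc.IH[of "i + 1"] sine_sum_second_difference[of k n "2 * int i + 1"]
        verlinde_poly_second_difference[OF k(1), of n "2 * real i + 1"]
      by (simp add: d_def algebra_simps)
  next
    show "d 0 = - d 1"
      \<comment> \<open>The polynomial is odd between \<open>- 1\<close> and \<open>1\<close> since
        its even part vanishes there; this fails for \<open>n = 0\<close>, which is the base
        case.\<close>
      using sine_sum_odd[of k "Suc n" 1] verlinde_poly_even[OF k(2), of "Suc n" 1]
      by (simp add: d_def even_fun_1)
  next
    show "d k = - d 1"
      using sine_sum_reflect[of k "Suc n" 1] verlinde_poly_reflect[OF k(2), of "Suc n" 1]
      by (simp add: d_def)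
  qed (use k Suc.prems in auto)
  then show ?case by (simp add: d_def)
qed

section \<open>Normalisation and the final expansion in powers of \<open>k\<close>\<close>

text \<open>The factors \<open>s = sqrt (2 / k)\<close> of the S-matrix entries combine to
  \<open>s / s ^ (2 * n + 1) = (k / 2) ^ n\<close>.\<close>

lemma verlinde_dim_eq_sine_sum:
  assumes "k \<ge> 1"
  shows "verlinde_dim (Suc n) k l = (real k / 2) ^ n * sine_sum k n (int l)"
proof -
  define s where "s = sqrt (2 / real k)"
  have s: "s \<noteq> 0" "s\<^sup>2 = 2 / real k" using assms by (simp_all add: s_def)
  have "S_matrix k m 1 powi (1 - 2 * int (Suc n)) * S_matrix k m l
    = (real k / 2) ^ n
      * (sin (pi * real m * real l / real k) / sin (pi * real m / real k) ^ (2 * n + 1))" for m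
  proof -
    have e: "1 - 2 * int (Suc n) = - int (2 * n + 1)" by simp
    have "S_matrix k m 1 powi (1 - 2 * int (Suc n)) * S_matrix k m l
      = s / s ^ (2 * n + 1)
        * (sin (pi * real m * real l / real k) / sin (pi * real m / real k) ^ (2 * n + 1))"
      unfolding e power_int_minus power_int_of_nat S_matrix_def s_def[symmetric] power_mult_distrib
      by (simp add: field_simps)
    also have "s / s ^ (2 * n + 1) = 1 / (s\<^sup>2) ^ n" using s(1) by (simp add: power_mult)
    also have "\<dots> = (real k / 2) ^ n" by (simp add: s(2) power_divide)
    finally show ?thesis .
  qed
  then show ?thesis by (simp add: verlinde_dim_def sine_sum_def sum_distrib_left)
qed

theorem theorem2p10:
  fixes g :: nat
  assumes "g \<ge> 1"
  shows "\<exists>(P :: nat \<Rightarrow> real poly) (lam :: nat \<Rightarrow> real).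
    (\<forall>k l :: nat. k \<ge> 1 \<longrightarrow> odd l \<longrightarrow> 1 \<le> l \<longrightarrow> l \<le> k - 1 \<longrightarrow>
       verlinde_dim g k l =
         (real k / (2 * pi)) ^ (3 * g - 2) *
         (\<Sum>m = 0..g - 1. real k powi (- 2 * int m) * poly (P m) (real l / real k))) \<and>
    (\<forall>m \<in> {0..g - 1}.
       degree (P m) = 2 * (g - m) - 1 \<and>
       even_part (P m) = monom (lam m) (2 * (g - m - 1))) \<and>
    lam 0 = 2 * C_const g * (2 * pi) ^ (3 * g - 2) / fact (2 * (g - 1))"
proof -
  obtain n where n: "g = Suc n" using assms by (cases g) auto
  have exponent: "3 * g - 2 = 3 * n + 1" using n by simp
  \<comment> \<open>The index \<open>n - m\<close> lists the top degree first;
    \<open>(2 * pi) ^ (3 * n + 1)\<close> compensates the prefactor of the claim and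
    \<open>2 ^ n\<close> comes from \<open>(k / 2) ^ n\<close>.\<close>
  define lam where "lam m = (2 * pi) ^ (3 * n + 1) / 2 ^ n * even_coeff n (n - m)" for m
  define P where "P m = smult (lam m) (bern (n - m))" for m
  have "verlinde_dim g k l = (real k / (2 * pi)) ^ (3 * g - 2)
      * (\<Sum>m = 0..g - 1. real k powi (- 2 * int m) * poly (P m) (real l / real k))"
    if "k \<ge> 1" "odd l" "1 \<le> l" "l \<le> k - 1" for k l
  proof -
    from \<open>odd l\<close> obtain j where j: "l = 2 * j + 1" by (rule oddE)
    have k: "real k \<noteq> 0" using that by simp
    have "verlinde_dim g k l = (real k / 2) ^ n * poly (verlinde_poly (real k) n) (real l)"
      using verlinde_dim_eq_sine_sum[of k n l] sine_sum_eq_verlinde_poly[of "j + 1" k n] that j n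
      by (simp add: algebra_simps)
    also have "\<dots> = (\<Sum>i\<le>n. (real k / 2) ^ n * (even_coeff n i * real k ^ (2 * i + 1)
        * poly (bern i) (real l / real k)))"
      by (simp add: poly_verlinde_poly sum_distrib_left)
    also have "\<dots> = (\<Sum>m = 0..n. (real k / 2) ^ n * (even_coeff n (n - m) * real k ^ (2 * (n - m) + 1)
        * poly (bern (n - m)) (real l / real k)))"
      by (rule sum.reindex_bij_witness[of _ "\<lambda>m. n - m" "\<lambda>m. n - m"]) auto
    also have "\<dots> = (\<Sum>m = 0..n. (real k / (2 * pi)) ^ (3 * n + 1)
        * (real k powi (- 2 * int m) * poly (P m) (real l / real k)))"
    proof (rule sum.cong[OF refl])
      fix m assume "m \<in> {0..n}"
      \<comment> \<open>Count of powers of \<open>k\<close>: normalisation,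
        \<open>verlinde_poly\<close>, and the surplus removed by
        \<open>k powi (- 2 * m)\<close>.\<close>
      then have "3 * n + 1 = n + (2 * (n - m) + 1) + 2 * m" by simp
      then have "real k ^ (3 * n + 1) = real k ^ n * real k ^ (2 * (n - m) + 1) * real k ^ (2 * m)"
        by (simp only: power_add)
      moreover have "real k powi (- 2 * int m) = inverse (real k ^ (2 * m))"
        using power_int_minus[of "real k" "int (2 * m)"] by (simp only: power_int_of_nat) simp
      ultimately have "(real k / (2 * pi)) ^ (3 * n + 1) * real k powi (- 2 * int m)
          * ((2 * pi) ^ (3 * n + 1) / 2 ^ n) = (real k / 2) ^ n * real k ^ (2 * (n - m) + 1)"
        using k by (simp only: power_divide) (simp add: field_simps)
      from arg_cong[OF this, of "\<lambda>c. c * (even_coeff n (n - m) * poly (bern (n - m)) (real l / real k))"]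
      show "(real k / 2) ^ n * (even_coeff n (n - m) * real k ^ (2 * (n - m) + 1)
          * poly (bern (n - m)) (real l / real k))
        = (real k / (2 * pi)) ^ (3 * n + 1)
          * (real k powi (- 2 * int m) * poly (P m) (real l / real k))"
        unfolding P_def lam_def poly_smult by (simp only: mult_ac)
    qed
    finally show ?thesis by (simp add: exponent n sum_distrib_left del: power_Suc)
  qed
  moreover have "degree (P m) = 2 * (g - m) - 1
      \<and> even_part (P m) = monom (lam m) (2 * (g - m - 1))" if "m \<in> {0..g - 1}" for m
  proof -
    have "m \<le> n" using that n by simp
    \<comment> \<open>A zero scalar would destroy the degree of \<open>P m\<close>.\<close>
    have "lam m \<noteq> 0"
      by (simp add: lam_def even_coeff_def coeff_odd_squares_poly_nonzero)
    then show ?thesis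
      using \<open>m \<le> n\<close> by (simp add: P_def n degree_bern even_part_smult even_part_bern smult_monom)
  qed
  moreover have "lam 0 = 2 * C_const g * (2 * pi) ^ (3 * g - 2) / fact (2 * (g - 1))"
  proof -
    have "2 * C_const g = (- 1) ^ n / 2 ^ n"
      unfolding C_const_def n power_int_minus power_int_of_nat by (simp add: field_simps)
    then show ?thesis
      unfolding exponent by (simp add: lam_def even_coeff_def lead_coeff_odd_squares_poly n)
  qed
  ultimately show ?thesis by blast
qed

end
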